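(* Let $K$, $L$ and $T$ be bounded Borel measurable sets in $\mathbb{R}^n$ and let $\Lambda\subset\mathbb{R}^n$ be a finite set with $K\subseteq \Lambda+T$. Then $$N(K,L)\leq \Bigl(1+\ln\bigl(\max_{x\in K-L} \operatorname{card}\bigl((x+(L\sim T))\cap \Lambda\bigr)\bigr)\Bigr)\cdot N^\ast(K-T,\,L\sim T).$$ If, moreover, $\Lambda\subset K$, then $$N(K,L)\leq \Bigl(1+\ln\bigl(\max_{x\in K-L} \operatorname{card}\bigl((x+(L\sim T))\cap \Lambda\bigr)\bigr)\Bigr)\cdot N^\ast(K,\,L\sim T).$$
   Context: For sets $A,B\subseteq\mathbb{R}^n$ and $x\in\mathbb{R}^n$: $A+B=\{a+b : a\in A, b\in B\}$, $A-B=\{a-b : a\in A, b\in B\}$, $x+A=\{x+a: a\in A\}$, $x-A=\{x-a : a\in A\}$. The Minkowski difference of $A$ and $B$ is $A\sim B=\{x\in\mathbb{R}^n : B+x\subseteq A\}$. $\operatorname{card}$ denotes cardinality and $\ln$ the natural logarithm. The translative covering number $N(A,B)$ is the minimum number of translates of $B$ whose union contains $A$. A fractional covering of $A$ by translates of $B$ is a Borel measure $\mu$ on $\mathbb{R}^n$ with $\mu(x-B)\geq 1$ for all $x\in A$. The fractional covering number is $$N^\ast(A,B)=\inf\{\mu(\mathbb{R}^n) : \mu \text{ is a fractional covering of } A \text{ by translates of } B\}.$$ *)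

theory Defs
  imports "HOL-Analysis.Analysis"
begin

text \<open>
  The sum \<open>A + B\<close> and the translate \<open>x +o A\<close> are those of \<open>HOL-Library.Set_Algebras\<close>.
  The operator \<open>-\<close> on sets is the set-theoretic difference, so \<open>A - B = {a - b}\<close> and
  \<open>x - A\<close> get names of their own.
\<close>

definition set_minus :: "'a::minus set \<Rightarrow> 'a set \<Rightarrow> 'a set" where
  "set_minus A B = {a - b | a b. a \<in> A \<and> b \<in> B}"

definition elt_set_minus :: "'a::minus \<Rightarrow> 'a set \<Rightarrow> 'a set" where
  "elt_set_minus x A = {x - a | a. a \<in> A}"

definition minkowski_difference :: "'a::plus set \<Rightarrow> 'a set \<Rightarrow> 'a set" where
  "minkowski_difference A B = {x. x +o B \<subseteq> A}"

text \<open>The value is \<open>\<infinity>\<close> if no finite family of translates covers.\<close>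

definition covering_number :: "'a::plus set \<Rightarrow> 'a set \<Rightarrow> enat" where
  "covering_number A B =
     (INF F \<in> {F. finite F \<and> F \<subseteq> range (\<lambda>x. x +o B) \<and> A \<subseteq> \<Union>F}. enat (card F))"

text \<open>
  The Minkowski difference of two Borel sets is in general only coanalytic, not Borel, and
  \<open>emeasure \<mu>\<close> is \<open>0\<close> by convention outside \<open>sets \<mu>\<close>.  Coanalytic sets are measurable for the
  completion of every finite Borel measure, so \<open>\<mu> (x - B)\<close> is read as the value of the
  completed measure; for Borel \<open>B\<close> this is \<open>emeasure \<mu>\<close> itself.
\<close>

definition fractional_covering ::
    "'a::{minus,topological_space} measure \<Rightarrow> 'a set \<Rightarrow> 'a set \<Rightarrow> bool" where
  "fractional_covering \<mu> A B \<longleftrightarrow>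
     sets \<mu> = sets borel \<and> (\<forall>x\<in>A. emeasure (completion \<mu>) (elt_set_minus x B) \<ge> 1)"

definition fractional_covering_number ::
    "'a::{minus,topological_space} set \<Rightarrow> 'a set \<Rightarrow> ennreal" where
  "fractional_covering_number A B = (INF \<mu> \<in> {\<mu>. fractional_covering \<mu> A B}. emeasure \<mu> UNIV)"

text \<open>
  The range of the cardinalities below is finite when \<open>\<Lambda>\<close> is, so \<open>Max\<close> is the true maximum
  whenever \<open>K - L\<close> is nonempty.  The degenerate cases rely on no particular value: as
  \<open>ln 0 = 0\<close> in HOL, the factor is at least \<open>1\<close> whatever the natural number \<open>Max {}\<close> is.
  If \<open>K\<close> is empty, it multiplies \<open>0\<close>; if \<open>K\<close> is nonempty and \<open>L \<sim> T\<close> is empty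
  (in particular if \<open>L\<close> is empty), it multiplies \<open>\<infinity>\<close>.  In all other cases the maximum is
  at least \<open>1\<close>.
\<close>

definition max_degree :: "'a::{plus,minus} set \<Rightarrow> 'a set \<Rightarrow> 'a set \<Rightarrow> 'a set \<Rightarrow> nat" where
  "max_degree K L T \<Lambda> =
     Max ((\<lambda>x. card ((x +o minkowski_difference L T) \<inter> \<Lambda>)) ` set_minus K L)"

end

theory Submission
  imports Defs
begin

text \<open>
  Write \<open>M = L \<sim> T\<close>.  Since \<open>K \<subseteq> \<Lambda> + T\<close> and \<open>M + T \<subseteq> L\<close>, translates of \<open>M\<close> that cover the finitely
  many points of \<open>\<Lambda>\<close> turn into as many translates of \<open>L\<close> that cover \<open>K\<close>, by the same shift vectors.
  Only the points \<open>v\<close> of \<open>\<Lambda>\<close> for which \<open>v + T\<close> meets \<open>K\<close> have to be covered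
  (\<open>covering_number_le_of_cover_net\<close>); these lie in \<open>K - T\<close>, and in \<open>K\<close> if \<open>\<Lambda> \<subseteq> K\<close>, so both
  inequalities are instances of one statement.  A translate \<open>x + M\<close> that contains one of these
  points has \<open>x \<in> K - L\<close>, which is why the maximum over \<open>K - L\<close> controls all translates that matter.

  What remains is the inequality of Lovasz and Stein between the integral and the fractional
  covering number of a hypergraph on a finite vertex set, with a measure in place of edge weights.
  Cover greedily, always by an edge that contains the largest number \<open>m\<close> of uncovered vertices, and
  let each of these pay \<open>1/m\<close>.  Then the total payment \<open>\<Sum>v. c v\<close> accounts for all edges that
  are used, while the vertices of any one edge with \<open>d\<close> vertices pay at most the harmonic number
  \<open>1 + 1/2 + \<dots> + 1/d \<le> 1 + ln d\<close> (\<open>greedy_cover_prices\<close>).  If \<open>\<mu> (v - M) \<ge> 1\<close> for all \<open>v\<close>, then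
  the number of edges is at most \<open>\<Sum>v. c v * \<mu> (v - M)\<close>, which is the integral over \<open>x\<close> of the payment
  of the edge \<open>x + M\<close>, hence at most \<open>1 + ln D\<close> times the total mass, with \<open>D\<close> the largest edge size
  (\<open>greedy_cover_le_measure\<close>).
\<close>

section \<open>Greedy coverings and harmonic numbers\<close>

text \<open>The last \<open>k\<close> terms of the harmonic sum \<open>harm (j + k)\<close> are at least \<open>1/(j + k)\<close> each.\<close>

lemma harm_add_ge:
  assumes "j + k \<le> m"
  shows "harm j + real k / real m \<le> harm (j + k)"
  using assms
proof (induction k)
  case (Suc k)
  have "1 / real m \<le> inverse (real (Suc (j + k)))"
    using Suc.prems by (simp add: field_simps)
  moreover have "harm j + real k / real m \<le> harm (j + k)"
    using Suc by simp
  ultimately show ?case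
    by (simp add: harm_Suc add_divide_distrib)
qed simp

lemma harm_le_one_plus_ln:
  assumes "d \<le> n"
  shows "harm d \<le> 1 + ln (real n)"
proof (cases "d = 0")
  case True
  \<comment> \<open>For \<open>n = 0\<close> the bound is \<open>1\<close>, since \<open>ln 0 = 0\<close>.\<close>
  then show ?thesis by (cases "n = 0") (auto simp: harm_def)
next
  case False
  have "harm d \<le> (harm n :: real)"
    using assms by (rule harm_mono)
  also have "\<dots> \<le> 1 + ln (real n)"
    using euler_mascheroni_sequence_decreasing[of 1 n] assms False by (simp add: harm_expand)
  finally show ?thesis .
qed

text \<open>
  The price \<open>c v\<close> is \<open>1/m\<close> if \<open>v\<close> is first covered by an edge that covers \<open>m\<close> new vertices.
  The bound on the payment of an edge \<open>E y\<close> survives the induction: of its \<open>n\<close> uncovered vertices,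
  \<open>k\<close> are covered now and pay \<open>1/m\<close> each, where \<open>n \<le> m\<close> by the greedy choice, and
  \<open>k/m + harm (n - k) \<le> harm n\<close>.
\<close>

lemma greedy_cover_prices:
  fixes E :: "'a \<Rightarrow> 'b set"
  assumes "finite V" and "V \<subseteq> (\<Union>x. E x)"
  shows "\<exists>X c. finite X \<and> V \<subseteq> (\<Union>x\<in>X. E x) \<and> (\<forall>v. c v \<ge> (0::real)) \<and> real (card X) \<le> sum c V
           \<and> (\<forall>y. sum c (E y \<inter> V) \<le> harm (card (E y \<inter> V)))"
  using assms
proof (induction V rule: finite_psubset_induct)
  case (psubset V)
  show ?case
  proof (cases "V = {}")
    case True
    then show ?thesis
      by (intro exI[of _ "{}"] exI[of _ "\<lambda>_. 0"]) (auto simp: harm_def)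
  next
    case False
    have bdd: "card (E y \<inter> V) \<le> card V" for y
      using psubset.hyps by (intro card_mono) auto
    define m where "m = Max (range (\<lambda>y. card (E y \<inter> V)))"
    have fin: "finite (range (\<lambda>y. card (E y \<inter> V)))"
      by (rule finite_subset[of _ "{..card V}"]) (use bdd in auto)
    have le_m: "card (E y \<inter> V) \<le> m" for y
      unfolding m_def by (intro Max_ge fin) auto
    have "m \<in> range (\<lambda>y. card (E y \<inter> V))"
      unfolding m_def by (intro Max_in fin) auto
    then obtain x where x: "m = card (E x \<inter> V)"
      by auto
    obtain v y where "v \<in> V" "v \<in> E y"
      using False psubset.prems by blast
    then have "card (E y \<inter> V) > 0"
      using psubset.hyps by (auto simp: card_gt_0_iff)
    then have "m > 0"
      using le_m[of y] by simp
    then have "E x \<inter> V \<noteq> {}"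
      using x by force
    then have "V - E x \<subset> V"
      by blast
    then obtain X c where fX: "finite X" and cover: "V - E x \<subseteq> (\<Union>x\<in>X. E x)"
      and c0: "\<And>v. c v \<ge> (0::real)" and c_sum: "real (card X) \<le> sum c (V - E x)"
      and c_le: "\<And>y. sum c (E y \<inter> (V - E x)) \<le> harm (card (E y \<inter> (V - E x)))"
      using psubset.IH[of "V - E x"] psubset.prems by blast
    define c' where "c' v = (if v \<in> E x then 1 / real m else c v)" for v
    have split: "sum c' W = real (card (E x \<inter> W)) / real m + sum c (W - E x)" if "finite W" for W
    proof -
      have "sum c' W = sum c' (E x \<inter> W) + sum c' (W - E x)"
        using that by (subst sum.union_disjoint[symmetric]) (auto intro!: sum.cong)
      then show ?thesis
        by (simp add: c'_def)
    qed
    have mass: "real (card (insert x X)) \<le> sum c' V"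
    proof -
      have "real (card (insert x X)) \<le> 1 + real (card X)"
        using fX by (simp add: card_insert_if)
      also have "\<dots> \<le> 1 + sum c (V - E x)"
        using c_sum by simp
      also have "\<dots> = sum c' V"
        using \<open>m > 0\<close> x split[OF psubset.hyps] by simp
      finally show ?thesis .
    qed
    have pay: "sum c' (E y \<inter> V) \<le> harm (card (E y \<inter> V))" for y
    proof -
      define k where "k = card (E x \<inter> (E y \<inter> V))"
      define j where "j = card (E y \<inter> (V - E x))"
      have "E y \<inter> V = (E y \<inter> (V - E x)) \<union> (E x \<inter> (E y \<inter> V))"
        by blast
      also have "card \<dots> = j + k"
        using psubset.hyps unfolding j_def k_def by (intro card_Un_disjoint) auto
      finally have jk: "card (E y \<inter> V) = j + k" .
      have "sum c' (E y \<inter> V) = real k / real m + sum c (E y \<inter> V - E x)"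
        using split[of "E y \<inter> V"] psubset.hyps by (simp add: k_def)
      also have "\<dots> \<le> real k / real m + harm j"
        using c_le[of y] by (simp add: j_def Int_Diff)
      also have "\<dots> \<le> harm (j + k)"
        using harm_add_ge[of j k m] le_m[of y] jk by simp
      finally show ?thesis
        by (simp add: jk)
    qed
    have "V \<subseteq> (\<Union>z\<in>insert x X. E z)"
      using cover by blast
    moreover have "\<forall>v. c' v \<ge> 0"
      using c0 by (simp add: c'_def)
    ultimately show ?thesis
      using fX mass pay by blast
  qed
qed

section \<open>Integral against fractional coverings\<close>

text \<open>
  Here \<open>S v\<close> is the set of all \<open>x\<close> whose edge contains the vertex \<open>v\<close>, and \<open>\<mu>\<close> is a fractional
  choice of edges.  Weighting the hypotheses \<open>\<mu> (S v) \<ge> 1\<close> with the greedy prices bounds the number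
  of edges by an integral whose integrand at \<open>x\<close> is the payment of the edge of \<open>x\<close>.
  The sets \<open>S v\<close> are measurable because \<open>emeasure\<close> vanishes outside \<open>sets \<mu>\<close>.
\<close>

lemma greedy_cover_le_measure:
  fixes \<mu> :: "'a measure"
  assumes "finite V"
    and mass: "\<And>v. v \<in> V \<Longrightarrow> emeasure \<mu> (S v) \<ge> 1"
    and deg: "\<And>x. card {v \<in> V. x \<in> S v} \<le> d"
  shows "\<exists>X. finite X \<and> (\<forall>v\<in>V. \<exists>x\<in>X. x \<in> S v)
           \<and> of_nat (card X) \<le> ennreal (1 + ln (real d)) * emeasure \<mu> (space \<mu>)"
proof -
  define E where "E x = {v. x \<in> S v}" for x
  have nonempty: "S v \<noteq> {}" if "v \<in> V" for v
    using mass[OF that] by auto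
  have meas: "S v \<in> sets \<mu>" if "v \<in> V" for v
    using mass[OF that] emeasure_notin_sets[of "S v" \<mu>] by force
  have "V \<subseteq> (\<Union>x. E x)"
    using nonempty by (auto simp: E_def)
  then obtain X c where X: "finite X" "V \<subseteq> (\<Union>x\<in>X. E x)" and c0: "\<And>v. c v \<ge> (0::real)"
    and c_sum: "real (card X) \<le> sum c V"
    and c_le: "\<And>y. sum c (E y \<inter> V) \<le> harm (card (E y \<inter> V))"
    using greedy_cover_prices[OF \<open>finite V\<close>, of E] by blast
  have pay: "(\<Sum>v\<in>V. ennreal (c v) * indicator (S v) x) \<le> ennreal (1 + ln (real d))" for x
  proof -
    have "(\<Sum>v\<in>V. ennreal (c v) * indicator (S v) x) = (\<Sum>v\<in>E x \<inter> V. ennreal (c v))"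
      using \<open>finite V\<close> by (intro sum.mono_neutral_cong_right)
          (auto simp: E_def indicator_def split: if_splits)
    also have "\<dots> = ennreal (sum c (E x \<inter> V))"
      using c0 by simp
    also have "card (E x \<inter> V) \<le> d"
      using deg[of x] by (simp add: E_def Collect_conj_eq Int_commute)
    then have "ennreal (sum c (E x \<inter> V)) \<le> ennreal (1 + ln (real d))"
      using c_le[of x] harm_le_one_plus_ln by (intro ennreal_leI) (rule order_trans)
    finally show ?thesis .
  qed
  have "of_nat (card X) = ennreal (real (card X))"
    by (simp add: ennreal_of_nat_eq_real_of_nat)
  also have "\<dots> \<le> ennreal (sum c V)"
    by (rule ennreal_leI[OF c_sum])
  also have "\<dots> = (\<Sum>v\<in>V. ennreal (c v))"
    using c0 by simp
  also have "\<dots> \<le> (\<Sum>v\<in>V. ennreal (c v) * emeasure \<mu> (S v))"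
  proof (intro sum_mono)
    fix v assume "v \<in> V"
    then show "ennreal (c v) \<le> ennreal (c v) * emeasure \<mu> (S v)"
      using mult_left_mono[OF mass, of v "ennreal (c v)"] by simp
  qed
  also have "\<dots> = (\<integral>\<^sup>+x. (\<Sum>v\<in>V. ennreal (c v) * indicator (S v) x) \<partial>\<mu>)"
    using meas by (subst nn_integral_sum) (auto simp: nn_integral_cmult_indicator intro!: sum.cong)
  also have "\<dots> \<le> (\<integral>\<^sup>+x. ennreal (1 + ln (real d)) \<partial>\<mu>)"
    by (intro nn_integral_mono pay)
  also have "\<dots> = ennreal (1 + ln (real d)) * emeasure \<mu> (space \<mu>)"
    by simp
  finally show ?thesis
    using X by (intro exI[of _ X]) (auto simp: E_def)
qed

section \<open>From covering the net to covering the set\<close>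

lemma covering_number_le_card:
  assumes "finite X" and "A \<subseteq> (\<Union>x\<in>X. x +o B)"
  shows "covering_number A B \<le> enat (card X)"
proof -
  have "covering_number A B \<le> enat (card ((\<lambda>x. x +o B) ` X))"
    unfolding covering_number_def using assms by (intro INF_lower) auto
  also have "\<dots> \<le> enat (card X)"
    using assms by (simp add: card_image_le)
  finally show ?thesis .
qed

text \<open>
  If \<open>k = v + t \<in> K\<close> and \<open>v = x + p\<close> with \<open>p \<in> L \<sim> T\<close>, then \<open>k = x + (p + t)\<close> and \<open>p + t \<in> L\<close>: the shift
  vectors that cover the net with translates of \<open>L \<sim> T\<close> cover \<open>K\<close> with translates of \<open>L\<close>.
\<close>

lemma covering_number_le_of_cover_net:
  fixes K L T \<Lambda> X :: "'a::ab_group_add set"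
  assumes "K \<subseteq> \<Lambda> + T" and "finite X"
    and net: "{v \<in> \<Lambda>. \<exists>t\<in>T. v + t \<in> K} \<subseteq> (\<Union>x\<in>X. x +o minkowski_difference L T)"
  shows "covering_number K L \<le> enat (card X)"
proof (rule covering_number_le_card[OF \<open>finite X\<close>], rule subsetI)
  fix k assume "k \<in> K"
  then obtain l t where "l \<in> \<Lambda>" "t \<in> T" "k = l + t"
    using assms(1) by (blast elim: set_plus_elim)
  then obtain x p where "x \<in> X" "p \<in> minkowski_difference L T" "l = x + p"
    using net \<open>k \<in> K\<close> by (fastforce simp: elt_set_plus_def)
  moreover from this \<open>t \<in> T\<close> have "p + t \<in> L"
    by (auto simp: minkowski_difference_def elt_set_plus_def)
  ultimately show "k \<in> (\<Union>x\<in>X. x +o L)"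
    using \<open>k = l + t\<close> by (auto simp: elt_set_plus_def add.assoc)
qed

text \<open>
  Let \<open>v = x + p\<close> with \<open>p \<in> L \<sim> T\<close>.  If \<open>v + t \<in> K\<close> for some \<open>t \<in> T\<close>, then
  \<open>x = (v + t) - (p + t)\<close> lies in \<open>K - L\<close>.  Translates with other \<open>x\<close> contain none of these points.
\<close>

lemma card_net_le_max_degree:
  fixes K L T \<Lambda> :: "'a::ab_group_add set"
  assumes "finite \<Lambda>"
  shows "card {v \<in> {v \<in> \<Lambda>. \<exists>t\<in>T. v + t \<in> K}. v \<in> x +o minkowski_difference L T}
           \<le> max_degree K L T \<Lambda>" (is "card ?W \<le> _")
proof (cases "?W = {}")
  case False
  then obtain p t where "x + p + t \<in> K" "p + t \<in> L"
    by (auto simp: minkowski_difference_def elt_set_plus_def)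
  moreover have "x = (x + p + t) - (p + t)"
    by simp
  ultimately have x: "x \<in> set_minus K L"
    unfolding set_minus_def by blast
  let ?deg = "\<lambda>x. card ((x +o minkowski_difference L T) \<inter> \<Lambda>)"
  have "finite (range ?deg)"
    by (rule finite_subset[of _ "{..card \<Lambda>}"]) (auto intro: card_mono assms)
  then have "finite (?deg ` set_minus K L)"
    by (rule finite_subset[rotated]) auto
  then have "?deg x \<le> max_degree K L T \<Lambda>"
    unfolding max_degree_def using x by (intro Max_ge) auto
  moreover have "card ?W \<le> ?deg x"
    using assms by (intro card_mono) auto
  ultimately show ?thesis
    by simp
qed (simp only: card.empty le0)

text \<open>
  Both inequalities of the theorem are instances of this one, with \<open>A = K - T\<close> and \<open>A = K\<close>.
  The sets \<open>v - (L \<sim> T)\<close> need not be Borel, so the integral bound is applied to \<open>completion \<mu>\<close>,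
  which has the same total mass as \<open>\<mu>\<close>.
\<close>

lemma covering_number_le_fractional:
  fixes K L T \<Lambda> A :: "'a::{ab_group_add,topological_space} set"
  assumes "finite \<Lambda>" and "K \<subseteq> \<Lambda> + T"
    and net: "{v \<in> \<Lambda>. \<exists>t\<in>T. v + t \<in> K} \<subseteq> A"
  shows "ennreal_of_enat (covering_number K L) \<le>
           ennreal (1 + ln (real (max_degree K L T \<Lambda>)))
             * fractional_covering_number A (minkowski_difference L T)"
    (is "?N \<le> ?c * _")
proof -
  let ?V = "{v \<in> \<Lambda>. \<exists>t\<in>T. v + t \<in> K}"
  let ?M = "minkowski_difference L T"
  have reflect: "x \<in> elt_set_minus v ?M \<longleftrightarrow> v \<in> x +o ?M" for x v
    by (auto simp: elt_set_minus_def elt_set_plus_def algebra_simps)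
  have bound: "?N \<le> ?c * emeasure \<mu> UNIV" if \<mu>: "fractional_covering \<mu> A ?M" for \<mu>
  proof -
    have space: "space \<mu> = UNIV"
      using \<mu> sets_eq_imp_space_eq[of \<mu> borel] by (simp add: fractional_covering_def)
    have "\<exists>X. finite X \<and> (\<forall>v\<in>?V. \<exists>x\<in>X. x \<in> elt_set_minus v ?M)
            \<and> of_nat (card X) \<le> ?c * emeasure (completion \<mu>) (space (completion \<mu>))"
    proof (rule greedy_cover_le_measure)
      show "finite ?V"
        using \<open>finite \<Lambda>\<close> by simp
      show "emeasure (completion \<mu>) (elt_set_minus v ?M) \<ge> 1" if "v \<in> ?V" for v
        using \<mu> net that unfolding fractional_covering_def by blast
      show "card {v \<in> ?V. x \<in> elt_set_minus v ?M} \<le> max_degree K L T \<Lambda>" for x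
        unfolding reflect by (rule card_net_le_max_degree[OF \<open>finite \<Lambda>\<close>])
    qed
    then obtain X where X: "finite X" "\<forall>v\<in>?V. \<exists>x\<in>X. v \<in> x +o ?M"
      and le: "of_nat (card X) \<le> ?c * emeasure (completion \<mu>) (space (completion \<mu>))"
      unfolding reflect by blast
    have "covering_number K L \<le> enat (card X)"
      using X by (intro covering_number_le_of_cover_net[OF \<open>K \<subseteq> \<Lambda> + T\<close>]) auto
    then have "?N \<le> of_nat (card X)"
      by (metis ennreal_of_enat_enat ennreal_of_enat_le_iff)
    also have "\<dots> \<le> ?c * emeasure \<mu> UNIV"
      using le emeasure_completion[of "UNIV" \<mu>] sets.top[of \<mu>] by (simp add: space)
    finally show ?thesis .
  qed
  \<comment> \<open>A maximum \<open>0\<close> does no harm, as \<open>ln 0 = 0\<close>.  Since \<open>?c\<close> is positive and finite, it can be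
      divided out before passing to the infimum over \<open>\<mu>\<close>.\<close>
  have "ln (real (max_degree K L T \<Lambda>)) \<ge> 0"
    by (cases "max_degree K L T \<Lambda>") auto
  then have c: "?c > 0" "?c \<noteq> \<infinity>"
    by (simp_all add: add_pos_nonneg del: ennreal_plus)
  have "?N / ?c \<le> fractional_covering_number A ?M"
    unfolding fractional_covering_number_def
    using bound c by (intro INF_greatest divide_le_posI_ennreal) auto
  then have "?c * (?N / ?c) \<le> ?c * fractional_covering_number A ?M"
    by (rule mult_left_mono) simp
  moreover have "?c * (?N / ?c) = ?N"
    using c by (simp add: ennreal_times_divide ennreal_mult_divide_eq mult.commute)
  ultimately show ?thesis
    by simp
qed

theorem theorem1p2:
  fixes K L T \<Lambda> :: "(real ^ 'n) set"
  assumes "bounded K" and "K \<in> sets borel"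
    and "bounded L" and "L \<in> sets borel"
    and "bounded T" and "T \<in> sets borel"
    and "finite \<Lambda>"
    and "K \<subseteq> \<Lambda> + T"
  shows "ennreal_of_enat (covering_number K L) \<le>
           ennreal (1 + ln (real (max_degree K L T \<Lambda>)))
             * fractional_covering_number (set_minus K T) (minkowski_difference L T)
         \<and> (\<Lambda> \<subseteq> K \<longrightarrow>
         ennreal_of_enat (covering_number K L) \<le>
           ennreal (1 + ln (real (max_degree K L T \<Lambda>)))
             * fractional_covering_number K (minkowski_difference L T))"
proof (intro conjI impI)
  have "l \<in> set_minus K T" if "t \<in> T" "l + t \<in> K" for l t
    using that unfolding set_minus_def by (intro CollectI exI[of _ "l + t"] exI[of _ t]) simp
  then show "ennreal_of_enat (covering_number K L) \<le>
      ennreal (1 + ln (real (max_degree K L T \<Lambda>)))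
        * fractional_covering_number (set_minus K T) (minkowski_difference L T)"
    using assms(7,8) by (intro covering_number_le_fractional) auto
next
  assume "\<Lambda> \<subseteq> K"
  then show "ennreal_of_enat (covering_number K L) \<le>
      ennreal (1 + ln (real (max_degree K L T \<Lambda>)))
        * fractional_covering_number K (minkowski_difference L T)"
    using assms(7,8) by (intro covering_number_le_fractional) auto
qed

end
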